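(* Let $d\in\mathbb N$, $T\ge 1/2$, $t_0=T-1/2$, and let $G:\mathcal P_2(\mathbb R^d)\to\mathbb R$ be $G(m)=\mathbf d_1(m,\mathrm{Leb}|_{[0,1]^d})$, where $\mathrm{Leb}|_{[0,1]^d}$ is Lebesgue measure restricted to the unit cube. Let $V^N$ and $U$ be the deterministic $N$-particle and mean field value functions on $\mathbb R^d$ with terminal cost $G$ defined in the context. Then there exist $c_d>0$ and $N_0\in\mathbb N$ such that for all $N\ge N_0$ there exists $\boldsymbol x^N\in([0,1]^d)^N$ with $$V^N(t_0,\boldsymbol x^N)-U(t_0,m^N_{\boldsymbol x^N})\ge c_d\,N^{-1/d}.$$
   Context: $\mathcal P_2(\mathbb R^d)$ is the space of Borel probability measures on $\mathbb R^d$ with finite second moment, $\mathbf d_1,\mathbf d_2$ are the 1- and 2-Wasserstein distances, and $m^N_{\boldsymbol x}=\frac1N\sum_{i=1}^N\delta_{x^i}$. **$N$-particle value function:** for $(t_0,\boldsymbol x_0)\in[0,T]\times(\mathbb R^d)^N$, $$V^N(t_0,\boldsymbol x_0)=\inf_{\alpha^1,\dots,\alpha^N\in L^2([t_0,T];\mathbb R^d)}\ \frac1N\sum_{i=1}^N\int_{t_0}^T\tfrac12|\alpha^i_t|^2dt+G(m^N_{\boldsymbol X_T}),\qquad \dot X^i_t=\alpha^i_t,\ X^i_{t_0}=x^i_0 .$$ **Mean field value function:** for $(t_0,m_0)\in[0,T]\times\mathcal P_2(\mathbb R^d)$, $$U(t_0,m_0)=\inf_{(m,\alpha)}\int_{t_0}^T\int_{\mathbb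 R^d}\tfrac12|\alpha_t(x)|^2dm_t(x)dt+G(m_T),$$ the infimum being over pairs with $m\in AC([t_0,T];\mathcal P_2(\mathbb R^d))$ (absolutely continuous curves), $\alpha\in L^2(dt\otimes m_t;\mathbb R^d)$, and $\partial_tm_t+\mathrm{div}(\alpha_tm_t)=0$ in $(t_0,T)\times\mathbb R^d$ (in the sense of distributions), $m_{t_0}=m_0$. *)

theory Defs
  imports "HOL-Probability.Probability"
begin

definition P2 :: "'a::euclidean_space measure set" where
  "P2 = {\<mu>. prob_space \<mu> \<and> sets \<mu> = sets borel \<and> integrable \<mu> (\<lambda>x. (norm x)\<^sup>2)}"

definition couplings ::
  "'a::euclidean_space measure \<Rightarrow> 'a measure \<Rightarrow> ('a \<times> 'a) measure set" where
  "couplings \<mu> \<nu> =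
     {\<gamma>. prob_space \<gamma> \<and> sets \<gamma> = sets borel \<and> distr \<gamma> borel fst = \<mu> \<and> distr \<gamma> borel snd = \<nu>}"

text \<open>
  Only used for measures in \<^const>\<open>P2\<close> and \<open>p \<in> {1, 2}\<close>; there the infimum is finite
  (the product coupling has finite cost), so that \<^const>\<open>enn2real\<close> does not lose information.
\<close>

definition wasserstein ::
  "nat \<Rightarrow> 'a::euclidean_space measure \<Rightarrow> 'a measure \<Rightarrow> real" where
  "wasserstein p \<mu> \<nu> =
     root p (enn2real (INF \<gamma>\<in>couplings \<mu> \<nu>. \<integral>\<^sup>+ z. ennreal (dist (fst z) (snd z) ^ p) \<partial>\<gamma>))"

text \<open>
  The empirical measure \<open>(1/N) \<Sum>\<^sub>i \<delta>\<^bsub>x i\<^esub>\<close> of the points \<open>x 0, \<dots>, x (N - 1)\<close>. Configurations of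
  \<open>N\<close> particles are functions on \<^typ>\<open>nat\<close> of which only the values below \<open>N\<close> are relevant.
\<close>

definition empirical_measure :: "nat \<Rightarrow> (nat \<Rightarrow> 'a::euclidean_space) \<Rightarrow> 'a measure" where
  "empirical_measure N x = distr (uniform_count_measure {..<N}) borel x"

lemma measure_empirical_measure:
  assumes "A \<in> sets borel"
  shows "measure (empirical_measure N x) A = 1 / real N * (\<Sum>i<N. indicator A (x i))"
proof -
  have "measure (empirical_measure N x) A
        = measure (uniform_count_measure {..<N}) (x -` A \<inter> {..<N})"
    unfolding empirical_measure_def
    by (subst measure_distr)
       (use assms in \<open>auto simp: space_uniform_count_measure measurable_def sets_uniform_count_measure\<close>)
  also have "\<dots> = card (x -` A \<inter> {..<N}) / card {..<N}"
    by (rule measure_uniform_count_measure) auto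
  also have "real (card (x -` A \<inter> {..<N})) = (\<Sum>i<N. indicator A (x i))"
    by (simp add: indicator_def sum.If_cases Int_def vimage_def conj_commute)
  finally show ?thesis
    by simp
qed

text \<open>
  \<open>L\<^sup>2([t\<^sub>0,T]; \<real>\<^sup>d)\<close>, via Borel representatives.
\<close>

definition L2_control :: "real \<Rightarrow> real \<Rightarrow> (real \<Rightarrow> 'a::euclidean_space) \<Rightarrow> bool" where
  "L2_control t0 T \<alpha> \<longleftrightarrow>
     set_borel_measurable lborel {t0..T} \<alpha> \<and>
     set_integrable lborel {t0..T} (\<lambda>t. (norm (\<alpha> t))\<^sup>2)"

text \<open>
  The state equation \<open>X' = \<alpha>\<close>, \<open>X(t\<^sub>0) = x\<^sub>0\<close> for a control \<open>\<alpha>\<close> that is merely square integrable is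
  understood, as usual, in the integrated (Caratheodory) sense.
\<close>

definition controlled_path ::
  "real \<Rightarrow> real \<Rightarrow> 'a::euclidean_space \<Rightarrow> (real \<Rightarrow> 'a) \<Rightarrow> (real \<Rightarrow> 'a) \<Rightarrow> bool" where
  "controlled_path t0 T x0 \<alpha> X \<longleftrightarrow> (\<forall>t\<in>{t0..T}. X t = x0 + (LBINT s:{t0..t}. \<alpha> s))"

text \<open>
  The infima defining the two value functions are taken over sets of real numbers that are nonempty
  (zero control, constant curve) and, whenever \<open>G\<close> is bounded below, bounded below.
\<close>

definition particle_value ::
  "('a::euclidean_space measure \<Rightarrow> real) \<Rightarrow> real \<Rightarrow> nat \<Rightarrow> real \<Rightarrow> (nat \<Rightarrow> 'a) \<Rightarrow> real" where
  "particle_value G T N t0 x0 =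
     Inf {1 / real N * (\<Sum>i<N. LBINT t:{t0..T}. 1 / 2 * (norm (\<alpha> i t))\<^sup>2)
            + G (empirical_measure N (\<lambda>i. X i T)) | \<alpha> X.
          \<forall>i<N. L2_control t0 T (\<alpha> i) \<and> controlled_path t0 T (x0 i) (\<alpha> i) (X i)}"

text \<open>
  Absolutely continuous curves in the metric space \<open>(P2, d\<^sub>2)\<close>: the metric increments are dominated
  by the integral of an \<open>L\<^sup>1\<close> function (Ambrosio-Gigli-Savare).
\<close>

definition AC_P2 :: "real \<Rightarrow> real \<Rightarrow> (real \<Rightarrow> 'a::euclidean_space measure) \<Rightarrow> bool" where
  "AC_P2 t0 T m \<longleftrightarrow>
     (\<forall>t\<in>{t0..T}. m t \<in> P2) \<and>
     (\<exists>g :: real \<Rightarrow> real. set_integrable lborel {t0..T} g \<and>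
        (\<forall>s\<in>{t0..T}. \<forall>t\<in>{s..T}. wasserstein 2 (m s) (m t) \<le> (LBINT r:{s..t}. g r)))"

text \<open>
  \<open>L\<^sup>2(dt \<otimes> m\<^sub>t; \<real>\<^sup>d)\<close> on \<open>[t\<^sub>0,T] \<times> \<real>\<^sup>d\<close>, via jointly Borel measurable representatives.
\<close>

definition L2_vector_field ::
  "real \<Rightarrow> real \<Rightarrow> (real \<Rightarrow> 'a::euclidean_space measure) \<Rightarrow> (real \<Rightarrow> 'a \<Rightarrow> 'a) \<Rightarrow> bool" where
  "L2_vector_field t0 T m \<alpha> \<longleftrightarrow>
     set_borel_measurable borel ({t0..T} \<times> UNIV) (\<lambda>(t, x). \<alpha> t x) \<and>
     (\<integral>\<^sup>+ t\<in>{t0..T}. (\<integral>\<^sup>+ x. ennreal ((norm (\<alpha> t x))\<^sup>2) \<partial>m t) \<partial>lborel) < \<infinity>"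

primrec C_k :: "nat \<Rightarrow> ('b::euclidean_space \<Rightarrow> real) \<Rightarrow> bool" where
  "C_k 0 f \<longleftrightarrow> continuous_on UNIV f"
| "C_k (Suc k) f \<longleftrightarrow>
     (\<forall>z. f differentiable (at z)) \<and> (\<forall>v. C_k k (\<lambda>z. frechet_derivative f (at z) v))"

text \<open>\<open>C\<^sub>c\<^sup>\<infinity>((t\<^sub>0,T) \<times> \<real>\<^sup>d)\<close>, the functions being extended by zero to \<open>\<real> \<times> \<real>\<^sup>d\<close>.\<close>

definition test_function :: "real \<Rightarrow> real \<Rightarrow> (real \<times> 'a::euclidean_space \<Rightarrow> real) \<Rightarrow> bool" where
  "test_function t0 T \<phi> \<longleftrightarrow>
     (\<forall>k. C_k k \<phi>) \<and>
     compact (closure {z. \<phi> z \<noteq> 0}) \<and>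
     closure {z. \<phi> z \<noteq> 0} \<subseteq> {t0<..<T} \<times> UNIV"

text \<open>
  \<open>\<partial>\<^sub>t m\<^sub>t + div (\<alpha>\<^sub>t m\<^sub>t) = 0\<close> in the sense of distributions:
  \<open>\<integral>\<integral> (\<partial>\<^sub>t \<phi> + \<alpha>\<^sub>t \<bullet> \<nabla>\<phi>) dm\<^sub>t dt = 0\<close> for all test functions \<open>\<phi>\<close>. The first
  Frechet derivative below is \<open>\<partial>\<^sub>t \<phi>(t,x)\<close>, the second one is \<open>\<alpha>\<^sub>t(x) \<bullet> \<nabla>\<phi>(t,x)\<close>.
\<close>

definition continuity_equation ::
  "real \<Rightarrow> real \<Rightarrow> (real \<Rightarrow> 'a::euclidean_space measure) \<Rightarrow> (real \<Rightarrow> 'a \<Rightarrow> 'a) \<Rightarrow> bool" where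
  "continuity_equation t0 T m \<alpha> \<longleftrightarrow>
     (\<forall>\<phi>. test_function t0 T \<phi> \<longrightarrow>
        (LBINT t:{t0<..<T}. LINT x|m t.
           frechet_derivative \<phi> (at (t, x)) (1, 0)
           + frechet_derivative \<phi> (at (t, x)) (0, \<alpha> t x)) = 0)"

definition mean_field_value ::
  "('a::euclidean_space measure \<Rightarrow> real) \<Rightarrow> real \<Rightarrow> real \<Rightarrow> 'a measure \<Rightarrow> real" where
  "mean_field_value G T t0 m0 =
     Inf {(LBINT t:{t0..T}. LINT x|m t. 1 / 2 * (norm (\<alpha> t x))\<^sup>2) + G (m T) | m \<alpha>.
          AC_P2 t0 T m \<and> L2_vector_field t0 T m \<alpha> \<and> continuity_equation t0 T m \<alpha> \<and> m t0 = m0}"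

definition lebesgue_unit_cube :: "(real ^ 'd) measure" where
  "lebesgue_unit_cube = density lborel (indicator (cbox 0 1))"

definition terminal_cost :: "(real ^ 'd) measure \<Rightarrow> real" where
  "terminal_cost m = wasserstein 1 m lebesgue_unit_cube"

end

theory Submission
  imports Defs
begin

text \<open>
  The gap is a quantization effect. The balls of radius \<open>r = N\<^sup>-\<^sup>1\<^sup>/\<^sup>d / 4\<close> around \<open>N\<close> points cover at
  most half of the cube, so that every \<open>N\<close>-point empirical measure has \<open>d\<^sub>1\<close>-distance at least
  \<open>r / 2\<close> from Lebesgue measure; hence the particle value is at least \<open>N\<^sup>-\<^sup>1\<^sup>/\<^sup>d / 8\<close>. For the
  mean field problem, cut the cube into \<open>N\<close> boxes of volume \<open>1 / N\<close> and diameter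
  \<open>O(N\<^sup>-\<^sup>1\<^sup>/\<^sup>d)\<close> and let \<open>x i\<close> be the lower corner of the \<open>i\<close>-th box. Inflating each corner
  linearly to its box steers the empirical measure of these corners to Lebesgue measure at a cost of
  only \<open>O(N\<^sup>-\<^sup>2\<^sup>/\<^sup>d)\<close>.
\<close>

subsection \<open>Wasserstein distances and quantization\<close>

lemma wasserstein_nonneg: "0 \<le> wasserstein p \<mu> \<nu>"
  unfolding wasserstein_def by (cases "p = 0") (auto intro!: real_root_ge_zero)

lemma wasserstein_le:
  assumes "\<gamma> \<in> couplings \<mu> \<nu>" "p > 0" "C \<ge> 0"
    and "(\<integral>\<^sup>+ z. ennreal (dist (fst z) (snd z) ^ p) \<partial>\<gamma>) \<le> ennreal (C ^ p)"
  shows "wasserstein p \<mu> \<nu> \<le> C"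
proof -
  have "(INF \<gamma>\<in>couplings \<mu> \<nu>. \<integral>\<^sup>+ z. ennreal (dist (fst z) (snd z) ^ p) \<partial>\<gamma>) \<le> ennreal (C ^ p)"
    using assms(1,4) by (rule INF_lower2)
  then have "root p (enn2real (INF \<gamma>\<in>couplings \<mu> \<nu>. \<integral>\<^sup>+ z. ennreal (dist (fst z) (snd z) ^ p) \<partial>\<gamma>))
      \<le> root p (C ^ p)"
    using assms by (intro real_root_le_mono enn2real_leI) auto
  then show ?thesis
    using assms by (simp add: wasserstein_def real_root_power_cancel)
qed

lemma borel_measurable_fst_snd [measurable]:
  "fst \<in> borel_measurable (borel :: ('a::topological_space \<times> 'b::topological_space) measure)"
  "snd \<in> borel_measurable (borel :: ('a \<times> 'b) measure)"
  by (auto intro!: borel_measurable_continuous_onI continuous_intros)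

text \<open>Every coupling constructed below is the joint law of two maps on one probability space:
  the diagonal, the projections of a product, or a flow at two times.\<close>

lemma distr_Pair_in_couplings:
  assumes "prob_space M" and [measurable]: "f \<in> borel_measurable M" "g \<in> borel_measurable M"
  shows "distr M borel (\<lambda>\<omega>. (f \<omega>, g \<omega>)) \<in> couplings (distr M borel f) (distr M borel g)"
proof -
  have [measurable]: "(\<lambda>\<omega>. (f \<omega>, g \<omega>)) \<in> M \<rightarrow>\<^sub>M borel"
    by (rule borel_measurable_Pair) auto
  show ?thesis
    unfolding couplings_def
    by (auto simp: distr_distr comp_def intro!: prob_space.prob_space_distr[OF assms(1)])
qed

lemma wasserstein_1_self:
  assumes "\<mu> \<in> P2"
  shows "wasserstein 1 \<mu> \<mu> = 0"
proof -
  have \<mu>: "prob_space \<mu>" "sets \<mu> = sets borel"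
    using assms by (auto simp: P2_def)
  have id[measurable]: "(\<lambda>x. x) \<in> \<mu> \<rightarrow>\<^sub>M borel"
    using \<mu>(2) by (simp add: measurable_ident_sets)
  have p[measurable]: "(\<lambda>x. (x, x)) \<in> \<mu> \<rightarrow>\<^sub>M borel"
    by (rule borel_measurable_Pair) auto
  have "distr \<mu> borel (\<lambda>x. (x, x)) \<in> couplings (distr \<mu> borel (\<lambda>x. x)) (distr \<mu> borel (\<lambda>x. x))"
    by (rule distr_Pair_in_couplings[OF \<mu>(1)]) auto
  moreover have "distr \<mu> borel (\<lambda>x. x) = \<mu>"
    using \<mu>(2) by (simp add: distr_id2)
  ultimately have "wasserstein 1 \<mu> \<mu> \<le> 0"
    by (intro wasserstein_le[where \<gamma> = "distr \<mu> borel (\<lambda>x. (x, x))"]) (auto simp: nn_integral_distr[OF p])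
  then show ?thesis
    using wasserstein_nonneg[of 1 \<mu> \<mu>] by simp
qed

text \<open>The infimum over couplings has to be shown finite, because \<open>enn2real\<close> sends
  infinity to 0 and would destroy a lower bound. The product coupling has finite cost: by a \<le> 1
  + a^2 the distance is controlled by the two second moments.\<close>

lemma wasserstein_1_ge:
  fixes \<mu> \<nu> :: "'a::euclidean_space measure"
  assumes \<mu>: "\<mu> \<in> P2" and \<nu>: "\<nu> \<in> P2"
    and le: "\<And>\<gamma>. \<gamma> \<in> couplings \<mu> \<nu> \<Longrightarrow> ennreal c \<le> (\<integral>\<^sup>+ z. ennreal (dist (fst z) (snd z)) \<partial>\<gamma>)"
  shows "c \<le> wasserstein 1 \<mu> \<nu>"
proof (cases "c \<ge> 0")
  case True
  interpret M: prob_space \<mu> using \<mu> by (simp add: P2_def)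
  interpret N: prob_space \<nu> using \<nu> by (simp add: P2_def)
  interpret MN: pair_prob_space \<mu> \<nu> ..
  have s[measurable_cong]: "sets \<mu> = sets borel" "sets \<nu> = sets borel"
    using \<mu> \<nu> by (auto simp: P2_def)
  let ?\<gamma> = "distr (\<mu> \<Otimes>\<^sub>M \<nu>) borel (\<lambda>z. (fst z, snd z))"
  have p[measurable]: "(\<lambda>z. (fst z, snd z)) \<in> \<mu> \<Otimes>\<^sub>M \<nu> \<rightarrow>\<^sub>M borel"
    by (rule borel_measurable_Pair) auto
  have "distr (\<mu> \<Otimes>\<^sub>M \<nu>) borel fst = \<mu>" "distr (\<mu> \<Otimes>\<^sub>M \<nu>) borel snd = \<nu>"
  proof -
    show "distr (\<mu> \<Otimes>\<^sub>M \<nu>) borel fst = \<mu>"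
      using N.distr_pair_fst[of \<mu>] s by (simp cong: distr_cong)
    show "distr (\<mu> \<Otimes>\<^sub>M \<nu>) borel snd = \<nu>"
    proof (rule measure_eqI)
      fix A assume A: "A \<in> sets (distr (\<mu> \<Otimes>\<^sub>M \<nu>) borel snd)"
      then have "emeasure (distr (\<mu> \<Otimes>\<^sub>M \<nu>) borel snd) A = emeasure (\<mu> \<Otimes>\<^sub>M \<nu>) (space \<mu> \<times> A)"
        using s sets.sets_into_space[of A \<nu>]
        by (auto simp: emeasure_distr space_pair_measure intro!: arg_cong[where f="emeasure _"])
      also have "\<dots> = emeasure \<nu> A"
        using A s by (subst N.emeasure_pair_measure_Times) (auto simp: M.emeasure_space_1)
      finally show "emeasure (distr (\<mu> \<Otimes>\<^sub>M \<nu>) borel snd) A = emeasure \<nu> A" .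
    qed (use s in auto)
  qed
  then have \<gamma>: "?\<gamma> \<in> couplings \<mu> \<nu>"
    using distr_Pair_in_couplings[OF MN.prob_space_axioms, of fst snd] by simp
  have b: "dist x y \<le> 2 + (norm x)\<^sup>2 + (norm y)\<^sup>2" for x y :: 'a
  proof -
    have "a \<le> 1 + a\<^sup>2" for a :: real
      using zero_le_power2[of "a - 1/2"] by (simp add: power2_eq_square algebra_simps)
    from this[of "norm x"] this[of "norm y"] show ?thesis
      using norm_triangle_ineq4[of x y] by (simp add: dist_norm)
  qed
  have fin: "(\<integral>\<^sup>+ x. ennreal ((norm x)\<^sup>2) \<partial>\<mu>) < \<infinity>" "(\<integral>\<^sup>+ x. ennreal ((norm x)\<^sup>2) \<partial>\<nu>) < \<infinity>"
    using \<mu> \<nu> by (auto simp: P2_def integrable_iff_bounded)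
  have "(\<integral>\<^sup>+ z. ennreal (dist (fst z) (snd z)) \<partial>?\<gamma>)
      = (\<integral>\<^sup>+ z. ennreal (dist (fst z) (snd z)) \<partial>(\<mu> \<Otimes>\<^sub>M \<nu>))"
    using p by (subst nn_integral_distr) auto
  also have "\<dots> \<le> (\<integral>\<^sup>+ z. 2 + ennreal ((norm (fst z))\<^sup>2) + ennreal ((norm (snd z))\<^sup>2) \<partial>(\<mu> \<Otimes>\<^sub>M \<nu>))"
  proof (rule nn_integral_mono)
    fix z :: "'a \<times> 'a"
    show "ennreal (dist (fst z) (snd z)) \<le> 2 + ennreal ((norm (fst z))\<^sup>2) + ennreal ((norm (snd z))\<^sup>2)"
      using ennreal_leI[OF b[of "fst z" "snd z"]] by (simp add: ennreal_plus)
  qed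
  also have "\<dots> = (\<integral>\<^sup>+ x. \<integral>\<^sup>+ y. 2 + ennreal ((norm x)\<^sup>2) + ennreal ((norm y)\<^sup>2) \<partial>\<nu> \<partial>\<mu>)"
    by (subst N.nn_integral_fst[symmetric]) auto
  also have "\<dots> = 2 + (\<integral>\<^sup>+ x. ennreal ((norm x)\<^sup>2) \<partial>\<mu>) + (\<integral>\<^sup>+ y. ennreal ((norm y)\<^sup>2) \<partial>\<nu>)"
    by (simp add: nn_integral_add M.emeasure_space_1 N.emeasure_space_1)
  also have "\<dots> < \<infinity>" using fin by simp
  finally have f: "(\<integral>\<^sup>+ z. ennreal (dist (fst z) (snd z)) \<partial>?\<gamma>) < \<infinity>" .
  let ?I = "INF \<gamma>\<in>couplings \<mu> \<nu>. \<integral>\<^sup>+ z. ennreal (dist (fst z) (snd z)) \<partial>\<gamma>"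
  have "?I < \<infinity>"
    using INF_lower[OF \<gamma>, of "\<lambda>\<gamma>. \<integral>\<^sup>+ z. ennreal (dist (fst z) (snd z)) \<partial>\<gamma>"] f by (rule le_less_trans)
  moreover have "ennreal c \<le> ?I" using le by (rule INF_greatest)
  ultimately have "c \<le> enn2real ?I"
    using enn2real_mono[of "ennreal c" ?I] True by (simp add: less_top)
  then show ?thesis by (simp add: wasserstein_def)
qed (use wasserstein_nonneg[of 1 \<mu> \<nu>] in linarith)

section \<open>Empirical measures as elements of \<open>P2\<close>\<close>

lemma bounded_in_P2:
  assumes "prob_space \<mu>" "sets \<mu> = sets borel" "AE x in \<mu>. norm x \<le> C"
  shows "\<mu> \<in> P2"
proof -
  interpret prob_space \<mu> by fact
  have "integrable \<mu> (\<lambda>x. (norm x)\<^sup>2)"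
    using assms by (intro integrable_const_bound[where B = "C\<^sup>2"])
      (auto simp: measurable_cong_sets[OF assms(2) refl] intro: power_mono elim!: eventually_mono)
  then show ?thesis using assms by (simp add: P2_def)
qed

lemma prob_space_empirical_measure:
  assumes "N > 0"
  shows "prob_space (empirical_measure N x)"
  unfolding empirical_measure_def using assms
  by (intro prob_space.prob_space_distr prob_space_uniform_count_measure)
     (auto simp: measurable_def sets_uniform_count_measure space_uniform_count_measure)

lemma AE_empirical_measure:
  assumes "N > 0"
  shows "AE z in empirical_measure N x. z \<in> x ` {..<N}"
proof -
  have "x \<in> uniform_count_measure {..<N} \<rightarrow>\<^sub>M borel"
    by (auto simp: measurable_def sets_uniform_count_measure space_uniform_count_measure)
  moreover have "AE i in uniform_count_measure {..<N}. x i \<in> x ` {..<N}"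
    by (rule AE_I2) (auto simp: space_uniform_count_measure)
  ultimately show ?thesis
    unfolding empirical_measure_def by (subst AE_distr_iff) (auto simp: finite_imp_closed)
qed

lemma empirical_measure_in_P2:
  assumes "N > 0"
  shows "empirical_measure N x \<in> P2"
proof (rule bounded_in_P2)
  show "AE z in empirical_measure N x. norm z \<le> Max ((norm \<circ> x) ` {..<N})"
    using AE_empirical_measure[OF assms] by eventually_elim auto
qed (use assms in \<open>auto simp: prob_space_empirical_measure, auto simp: empirical_measure_def\<close>)

section \<open>Quantization: distance of N-point measures from a measure dominated by Lebesgue
  measure\<close>

lemma emeasure_ball_le:
  fixes a :: "'a::euclidean_space"
  assumes "r \<ge> 0"
  shows "emeasure lborel (ball a r) \<le> ennreal ((2 * r) ^ DIM('a))"
proof -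
  have "ball a r \<subseteq> cbox (a - r *\<^sub>R One) (a + r *\<^sub>R One)"
  proof
    fix y assume "y \<in> ball a r"
    then have "norm (y - a) < r" by (simp add: dist_norm norm_minus_commute)
    then have "\<bar>(y - a) \<bullet> b\<bar> \<le> r" if "b \<in> Basis" for b
      using Basis_le_norm[OF that, of "y - a"] by linarith
    then show "y \<in> cbox (a - r *\<^sub>R One) (a + r *\<^sub>R One)"
      by (force simp: mem_box inner_diff_left inner_add_left abs_le_iff)
  qed
  then have "emeasure lborel (ball a r) \<le> emeasure lborel (cbox (a - r *\<^sub>R One) (a + r *\<^sub>R One))"
    by (intro emeasure_mono) auto
  also have "\<dots> = ennreal ((2 * r) ^ DIM('a))"
    using assms by (subst emeasure_lborel_cbox) (auto simp: inner_diff_left inner_add_left)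
  finally show ?thesis .
qed

text \<open>At least half of the mass of \<nu> lies outside the balls of radius r around the points.
  Under any coupling the first coordinate is almost surely one of the points, so this mass travels
  at least r. The side \<open>2 * r\<close> of an enclosing cube stands in for the exact volume of a
  ball.\<close>

lemma wasserstein_1_empirical_measure_ge:
  fixes \<nu> :: "'a::euclidean_space measure" and x :: "nat \<Rightarrow> 'a"
  assumes \<nu>: "\<nu> \<in> P2" and le: "\<And>A. A \<in> sets borel \<Longrightarrow> emeasure \<nu> A \<le> emeasure lborel A"
    and r: "r \<ge> 0" "real N * (2 * r) ^ DIM('a) \<le> 1 / 2" and "N > 0"
  shows "r / 2 \<le> wasserstein 1 (empirical_measure N x) \<nu>"
proof (rule wasserstein_1_ge[OF empirical_measure_in_P2 \<nu>])
  fix \<gamma> assume "\<gamma> \<in> couplings (empirical_measure N x) \<nu>"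
  then have \<gamma>: "prob_space \<gamma>" "distr \<gamma> borel fst = empirical_measure N x" "distr \<gamma> borel snd = \<nu>"
    and s[measurable_cong]: "sets \<gamma> = sets borel"
    by (auto simp: couplings_def)
  interpret \<nu>: prob_space \<nu> using \<nu> by (simp add: P2_def)
  have sn: "sets \<nu> = sets borel" "space \<nu> = UNIV"
    using \<nu> by (auto simp: P2_def dest: sets_eq_imp_space_eq)
  define B where "B = (\<Union>i<N. ball (x i) r)"
  have B[measurable]: "B \<in> sets borel" unfolding B_def by auto
  have "emeasure \<nu> B \<le> emeasure lborel B" using le B by blast
  also have "\<dots> \<le> (\<Sum>i<N. emeasure lborel (ball (x i) r))"
    unfolding B_def by (intro emeasure_subadditive_finite) auto
  also have "\<dots> \<le> (\<Sum>i<N. ennreal ((2 * r) ^ DIM('a)))"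
    by (intro sum_mono emeasure_ball_le r)
  also have "\<dots> = ennreal (real N * (2 * r) ^ DIM('a))"
    using r by (simp add: ennreal_mult ennreal_of_nat_eq_real_of_nat)
  also have "\<dots> \<le> ennreal (1 / 2)" using r by (intro ennreal_leI)
  finally have "\<nu>.prob B \<le> 1 / 2"
    by (simp only: \<nu>.emeasure_eq_measure ennreal_le_iff)
  then have "1 / 2 \<le> \<nu>.prob (- B)"
    using \<nu>.prob_compl[of B] B sn by (simp add: Compl_eq_Diff_UNIV)
  then have "ennreal (1 / 2) \<le> emeasure \<nu> (- B)"
    unfolding \<nu>.emeasure_eq_measure by (rule ennreal_leI)
  also have "\<dots> = (\<integral>\<^sup>+ y. indicator (- B) y \<partial>distr \<gamma> borel snd)"
    using B sn \<gamma> by (simp add: Compl_in_sets_lebesgue)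
  also have "\<dots> = (\<integral>\<^sup>+ z. indicator (- B) (snd z) \<partial>\<gamma>)"
    using B by (subst nn_integral_distr) auto
  finally have "ennreal r * ennreal (1 / 2) \<le> ennreal r * (\<integral>\<^sup>+ z. indicator (- B) (snd z) \<partial>\<gamma>)"
    by (rule mult_left_mono) simp
  also have "\<dots> = (\<integral>\<^sup>+ z. ennreal r * indicator (- B) (snd z) \<partial>\<gamma>)"
    using B by (subst nn_integral_cmult) auto
  also have "\<dots> \<le> (\<integral>\<^sup>+ z. ennreal (dist (fst z) (snd z)) \<partial>\<gamma>)"
  proof (rule nn_integral_mono_AE)
    have "AE z in distr \<gamma> borel fst. z \<in> x ` {..<N}"
      unfolding \<gamma>(2) by (rule AE_empirical_measure[OF \<open>N > 0\<close>])
    then have "AE z in \<gamma>. fst z \<in> x ` {..<N}"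
      by (subst (asm) AE_distr_iff) (auto simp: finite_imp_closed)
    then show "AE z in \<gamma>. ennreal r * indicator (- B) (snd z) \<le> ennreal (dist (fst z) (snd z))"
      by eventually_elim (auto simp: B_def indicator_def not_less intro!: ennreal_leI)
  qed
  also have "ennreal r * ennreal (1 / 2) = ennreal (r / 2)"
    using r by (subst ennreal_mult[symmetric]) auto
  finally show "ennreal (r / 2) \<le> (\<integral>\<^sup>+ z. ennreal (dist (fst z) (snd z)) \<partial>\<gamma>)" .
qed fact

section \<open>Lower bound for the N-particle problem\<close>

lemma particle_value_ge:
  assumes "\<And>y. c \<le> G (empirical_measure N y)"
  shows "c \<le> particle_value G T N t0 x"
  unfolding particle_value_def
proof (rule cInf_greatest)
  \<comment> \<open>Zero controls with constant paths make the set of costs nonempty; the infimum of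
    the empty set of reals would carry no information.\<close>
  have "\<forall>i<N. L2_control t0 T (\<lambda>_. 0) \<and> controlled_path t0 T (x i) (\<lambda>_. 0) (\<lambda>_. x i)"
    by (auto simp: L2_control_def controlled_path_def set_borel_measurable_def set_integrable_def)
  then have "\<exists>\<alpha> X. \<forall>i<N. L2_control t0 T (\<alpha> i) \<and> controlled_path t0 T (x i) (\<alpha> i) (X i)"
    by (intro exI[of _ "\<lambda>_ _. 0"] exI[of _ "\<lambda>i _. x i"])
  then show "{1 / real N * (\<Sum>i<N. LBINT t:{t0..T}. 1 / 2 * (norm (\<alpha> i t))\<^sup>2)
            + G (empirical_measure N (\<lambda>i. X i T)) | \<alpha> X.
          \<forall>i<N. L2_control t0 T (\<alpha> i) \<and> controlled_path t0 T (x i) (\<alpha> i) (X i)} \<noteq> {}"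
    by simp
next
  fix z assume "z \<in> {1 / real N * (\<Sum>i<N. LBINT t:{t0..T}. 1 / 2 * (norm (\<alpha> i t))\<^sup>2)
            + G (empirical_measure N (\<lambda>i. X i T)) | \<alpha> X.
          \<forall>i<N. L2_control t0 T (\<alpha> i) \<and> controlled_path t0 T (x i) (\<alpha> i) (X i)}"
  then show "c \<le> z"
    unfolding mem_Collect_eq
  proof (elim exE conjE)
    fix \<alpha> X assume z: "z = 1 / real N * (\<Sum>i<N. LBINT t:{t0..T}. 1 / 2 * (norm (\<alpha> i t))\<^sup>2)
            + G (empirical_measure N (\<lambda>i. X i T))"
    have "0 \<le> (\<Sum>i<N. LBINT t:{t0..T}. 1 / 2 * (norm (\<alpha> i t))\<^sup>2)"
      unfolding set_lebesgue_integral_def by (intro sum_nonneg integral_nonneg) auto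
    then show "c \<le> z"
      using assms[of "\<lambda>i. X i T"] z by (simp add: add_increasing)
  qed
qed

subsection \<open>Partitions into boxes of equal volume\<close>

text \<open>With the aspect ratio bounded, a box of volume h^d has diameter of order h. The factor 3
  matches the cuts used below: halving a number n \<ge> 2 of cells leaves at least n / 3 of them on
  each side.\<close>

definition fat_box :: "'a::euclidean_space \<Rightarrow> 'a \<Rightarrow> bool" where
  "fat_box a b \<longleftrightarrow> (\<forall>e\<in>Basis. a \<bullet> e < b \<bullet> e) \<and>
    (\<forall>e\<in>Basis. \<forall>e'\<in>Basis. (b - a) \<bullet> e \<le> 3 * ((b - a) \<bullet> e'))"

text \<open>
  The bound on the aspect ratio survives cutting a longest side in a ratio between \<open>1 / 3\<close> and
  \<open>2 / 3\<close>.
\<close>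

lemma fat_box_shorten:
  fixes a b a' b' e :: "'a::euclidean_space"
  assumes fat: "fat_box a b" and e: "e \<in> Basis"
    and long: "\<And>e'. e' \<in> Basis \<Longrightarrow> (b - a) \<bullet> e' \<le> (b - a) \<bullet> e"
    and \<theta>: "1 / 3 \<le> \<theta>" "\<theta> \<le> 1"
    and side: "b' - a' = (b - a) - ((1 - \<theta>) * ((b - a) \<bullet> e)) *\<^sub>R e"
  shows "fat_box a' b'"
    and "(\<Prod>e'\<in>Basis. (b' - a') \<bullet> e') = \<theta> * (\<Prod>e'\<in>Basis. (b - a) \<bullet> e')"
proof -
  let ?L = "(b - a) \<bullet> e"
  have L: "?L > 0" using fat e by (auto simp: fat_box_def inner_diff_left)
  have s: "(b' - a') \<bullet> e' = (if e' = e then \<theta> * ?L else (b - a) \<bullet> e')" if "e' \<in> Basis" for e'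
    using that e by (simp add: side inner_diff_left[of "b - a"] inner_Basis) (simp add: algebra_simps)
  \<comment> \<open>All new sides lie between \<open>?L / 3\<close> and \<open>?L\<close>: the cut
    one by the range of \<theta>, the others because \<open>e\<close> is a longest side and the old
    aspect ratio is at most 3.\<close>
  have lb: "?L \<le> 3 * ((b' - a') \<bullet> e')" if "e' \<in> Basis" for e'
    using that e fat \<theta> L mult_right_mono[of "1 / 3" \<theta> ?L] by (auto simp: s fat_box_def)
  have ub: "(b' - a') \<bullet> e' \<le> ?L" if "e' \<in> Basis" for e'
    using that long \<theta> L mult_right_mono[of \<theta> 1 ?L] by (auto simp: s)
  show "fat_box a' b'"
    unfolding fat_box_def
  proof (intro conjI ballI)
    fix e' :: 'a assume "e' \<in> Basis"
    then show "a' \<bullet> e' < b' \<bullet> e'"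
      using lb[of e'] L by (simp add: inner_diff_left)
  next
    fix e1 e2 :: 'a assume "e1 \<in> Basis" "e2 \<in> Basis"
    then show "(b' - a') \<bullet> e1 \<le> 3 * ((b' - a') \<bullet> e2)"
      using lb[of e2] ub[of e1] by linarith
  qed
  have "(\<Prod>e'\<in>Basis. (b' - a') \<bullet> e')
      = ((b' - a') \<bullet> e) * (\<Prod>e'\<in>Basis - {e}. (b' - a') \<bullet> e')"
    using e by (intro prod.remove) auto
  also have "(\<Prod>e'\<in>Basis - {e}. (b' - a') \<bullet> e') = (\<Prod>e'\<in>Basis - {e}. (b - a) \<bullet> e')"
    by (intro prod.cong refl) (auto simp: s)
  also have "(b' - a') \<bullet> e = \<theta> * ?L" using e by (simp add: s)
  also have "\<theta> * ?L * (\<Prod>e'\<in>Basis - {e}. (b - a) \<bullet> e') = \<theta> * (\<Prod>e'\<in>Basis. (b - a) \<bullet> e')"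
    using e by (subst (2) prod.remove[of _ e]) auto
  finally show "(\<Prod>e'\<in>Basis. (b' - a') \<bullet> e') = \<theta> * (\<Prod>e'\<in>Basis. (b - a) \<bullet> e')" .
qed

text \<open>Induction on n: split n into two nearly equal numbers, cut a longest side in the same
  proportion and recurse on both pieces. This treats every n, not only d-th powers. That the boxes
  cover up to a null set is recovered later from their volumes.\<close>

lemma fat_box_partition:
  fixes a b :: "'a::euclidean_space"
  assumes "n > 0" "fat_box a b"
  shows "\<exists>p q :: nat \<Rightarrow> 'a. (\<forall>i<n. fat_box (p i) (q i) \<and> box (p i) (q i) \<subseteq> box a b \<and>
      (\<Prod>e\<in>Basis. (q i - p i) \<bullet> e) = (\<Prod>e\<in>Basis. (b - a) \<bullet> e) / real n) \<and>
    disjoint_family_on (\<lambda>i. box (p i) (q i)) {..<n}"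
  using assms
proof (induction n arbitrary: a b rule: less_induct)
  case (less n)
  show ?case
  proof (cases "n = 1")
    case True
    then show ?thesis
      using less.prems by (intro exI[of _ "\<lambda>_. a"] exI[of _ "\<lambda>_. b"]) (simp add: disjoint_family_on_def)
  next
    case False
    let ?V = "\<Prod>e\<in>Basis. (b - a) \<bullet> e"
    define n1 n2 where "n1 = n div 2" and "n2 = n - n div 2"
    have n12: "n1 > 0" "n2 > 0" "n1 < n" "n2 < n" "n1 + n2 = n"
      using False less.prems(1) by (auto simp: n1_def n2_def)
    \<comment> \<open>For n \<ge> 2 the smaller half is at least n / 3, with equality at n = 3;
      hence both cutting fractions are at least 1 / 3.\<close>
    have third: "n \<le> 3 * n1" "n \<le> 3 * n2"
      using False less.prems(1) by (auto simp: n1_def n2_def)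
    define \<theta> where "\<theta> = real n1 / real n"
    have \<theta>': "1 - \<theta> = real n2 / real n"
      using n12 by (simp add: \<theta>_def field_simps flip: of_nat_add)
    have \<theta>: "1 / 3 \<le> \<theta>" "\<theta> \<le> 1" "1 / 3 \<le> 1 - \<theta>" "1 - \<theta> \<le> 1"
      unfolding \<theta>' unfolding \<theta>_def using n12 third by (auto simp: field_simps)
    obtain e :: 'a where e: "e \<in> Basis" and long: "\<And>e'. e' \<in> Basis \<Longrightarrow> (b - a) \<bullet> e' \<le> (b - a) \<bullet> e"
    proof -
      have "Max ((\<lambda>e. (b - a) \<bullet> e) ` Basis) \<in> (\<lambda>e. (b - a) \<bullet> e) ` Basis"
        by (intro Max_in) auto
      then obtain e :: 'a where "e \<in> Basis" "(b - a) \<bullet> e = Max ((\<lambda>e. (b - a) \<bullet> e) ` Basis)"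
        by (metis imageE)
      then show thesis by (intro that[of e]) auto
    qed
    let ?L = "(b - a) \<bullet> e"
    have L: "?L > 0" using less.prems(2) e by (auto simp: fat_box_def inner_diff_left)
    define b1 where "b1 = b - ((1 - \<theta>) * ?L) *\<^sub>R e"
    define a2 where "a2 = a + (\<theta> * ?L) *\<^sub>R e"
    \<comment> \<open>Both pieces have the old side vector shortened along \<open>e\<close> only, by
      the factors \<theta> and 1 - \<theta>. This common form lets \<open>fat_box_shorten\<close>
      treat the lower and the upper piece alike.\<close>
    have 1: "b1 - a = (b - a) - ((1 - \<theta>) * ?L) *\<^sub>R e"
      by (simp add: b1_def)
    have 2: "b - a2 = (b - a) - ((1 - (1 - \<theta>)) * ?L) *\<^sub>R e"
      by (simp add: a2_def)
    note f1 = fat_box_shorten[OF less.prems(2) e long \<theta>(1,2) 1]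
    note f2 = fat_box_shorten[OF less.prems(2) e long \<theta>(3,4) 2]
    obtain p1 q1 where pq1: "\<And>i. i < n1 \<Longrightarrow> fat_box (p1 i) (q1 i) \<and> box (p1 i) (q1 i) \<subseteq> box a b1 \<and>
        (\<Prod>e\<in>Basis. (q1 i - p1 i) \<bullet> e) = (\<Prod>e\<in>Basis. (b1 - a) \<bullet> e) / real n1"
      and d1: "disjoint_family_on (\<lambda>i. box (p1 i) (q1 i)) {..<n1}"
      using less.IH[OF n12(3,1) f1(1)] by blast
    obtain p2 q2 where pq2: "\<And>i. i < n2 \<Longrightarrow> fat_box (p2 i) (q2 i) \<and> box (p2 i) (q2 i) \<subseteq> box a2 b \<and>
        (\<Prod>e\<in>Basis. (q2 i - p2 i) \<bullet> e) = (\<Prod>e\<in>Basis. (b - a2) \<bullet> e) / real n2"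
      and d2: "disjoint_family_on (\<lambda>i. box (p2 i) (q2 i)) {..<n2}"
      using less.IH[OF n12(4,2) f2(1)] by blast
    have sub: "box a b1 \<subseteq> box a b" "box a2 b \<subseteq> box a b"
    proof -
      have *: "0 \<le> x * ?L * (e \<bullet> e')" if "x \<ge> 0" "e' \<in> Basis" for x e'
        using that e L by (simp add: inner_Basis)
      show "box a b1 \<subseteq> box a b"
        using *[of "1 - \<theta>"] \<theta> by (force simp: mem_box b1_def inner_diff_left[of b])
      show "box a2 b \<subseteq> box a b"
        using *[of \<theta>] \<theta> by (force simp: mem_box a2_def inner_add_left)
    qed
    \<comment> \<open>The pieces meet only in the cutting hyperplane, which open boxes omit.\<close>
    have disj: "box a b1 \<inter> box a2 b = {}"
    proof -
      have "b1 \<bullet> e = a2 \<bullet> e"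
        using e by (simp add: b1_def a2_def inner_diff_left inner_add_left algebra_simps)
      then show ?thesis
        using e by (force simp: mem_box)
    qed
    have v1: "(\<Prod>e\<in>Basis. (b1 - a) \<bullet> e) / real n1 = ?V / real n"
      using f1(2) n12 by (simp add: \<theta>_def)
    have v2: "(\<Prod>e\<in>Basis. (b - a2) \<bullet> e) / real n2 = ?V / real n"
      using f2(2) n12 by (simp add: \<theta>')
    let ?p = "\<lambda>i. if i < n1 then p1 i else p2 (i - n1)"
    let ?q = "\<lambda>i. if i < n1 then q1 i else q2 (i - n1)"
    have "fat_box (?p i) (?q i) \<and> box (?p i) (?q i) \<subseteq> box a b \<and>
        (\<Prod>e\<in>Basis. (?q i - ?p i) \<bullet> e) = ?V / real n" if i: "i < n" for i
    proof -
      have "i - n1 < n2" if "\<not> i < n1" using that i n12 by simp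
      then show ?thesis
        using pq1[of i] pq2[of "i - n1"] sub v1 v2 by auto
    qed
    moreover have "disjoint_family_on (\<lambda>i. box (?p i) (?q i)) {..<n}"
      unfolding disjoint_family_on_def
    proof (intro ballI impI)
      fix i j assume ij: "i \<in> {..<n}" "j \<in> {..<n}" "i \<noteq> j"
      have r: "k - n1 < n2" if "k < n" "\<not> k < n1" for k using that n12 by simp
      show "box (?p i) (?q i) \<inter> box (?p j) (?q j) = {}"
      proof (cases "i < n1"; cases "j < n1")
        assume "i < n1" "j < n1"
        then show ?thesis using d1 ij by (simp add: disjoint_family_on_def)
      next
        assume "i < n1" "\<not> j < n1"
        then show ?thesis using pq1[of i] pq2[of "j - n1"] r[of j] ij disj by auto
      next
        assume "\<not> i < n1" "j < n1"
        then show ?thesis using pq1[of j] pq2[of "i - n1"] r[of i] ij disj by auto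
      next
        assume "\<not> i < n1" "\<not> j < n1"
        moreover from this have "i - n1 \<noteq> j - n1" using ij by simp
        ultimately show ?thesis using d2 r[of i] r[of j] ij by (simp add: disjoint_family_on_def)
      qed
    qed
    ultimately have "(\<forall>i<n. fat_box (?p i) (?q i) \<and> box (?p i) (?q i) \<subseteq> box a b \<and>
        (\<Prod>e\<in>Basis. (?q i - ?p i) \<bullet> e) = ?V / real n) \<and>
        disjoint_family_on (\<lambda>i. box (?p i) (?q i)) {..<n}"
      by simp
    then show ?thesis
      by (rule_tac x = ?p in exI, rule_tac x = ?q in exI)
  qed
qed

text \<open>If one side exceeded 3 h, the aspect ratio would make every side exceed h, and the
  volume would exceed h^d. The factor \<open>DIM('a)\<close> comes from bounding the norm by the l1
  norm.\<close>

lemma norm_diff_fat_box_le: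
  fixes p q x :: "'a::euclidean_space" and h :: real
  assumes fat: "fat_box p q" and V: "(\<Prod>e\<in>Basis. (q - p) \<bullet> e) \<le> h ^ DIM('a)" "h \<ge> 0"
    and x: "x \<in> box p q"
  shows "norm (x - p) \<le> DIM('a) * (3 * h)"
proof -
  have "(q - p) \<bullet> e \<le> 3 * h" if e: "e \<in> Basis" for e
  proof (rule ccontr)
    assume *: "\<not> (q - p) \<bullet> e \<le> 3 * h"
    have "h < (q - p) \<bullet> e'" if "e' \<in> Basis" for e'
      using fat e that * unfolding fat_box_def by fastforce
    then have "(\<Prod>e\<in>(Basis::'a set). h) < (\<Prod>e\<in>Basis. (q - p) \<bullet> e)"
      using V(2) by (intro prod_mono_strict[where i = "SOME i. i \<in> Basis"]) (auto simp: SOME_Basis intro: less_imp_le le_less_trans)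
    then show False using V by simp
  qed
  moreover have "\<bar>(x - p) \<bullet> e\<bar> \<le> (q - p) \<bullet> e" if "e \<in> Basis" for e
    using x that by (force simp: mem_box inner_diff_left)
  ultimately have "(\<Sum>e\<in>Basis. \<bar>(x - p) \<bullet> e\<bar>) \<le> (\<Sum>e\<in>(Basis::'a set). 3 * h)"
    by (intro sum_mono) (meson order_trans)
  then show ?thesis
    using norm_le_l1[of "x - p"] by simp
qed

subsection \<open>Straight-line transport as a mean field control\<close>

lemma test_functionD:
  assumes "test_function t0 T \<phi>"
  shows test_function_has_derivative: "(\<phi> has_derivative frechet_derivative \<phi> (at z)) (at z)"
    and test_function_continuous_derivative: "continuous_on UNIV (\<lambda>z. frechet_derivative \<phi> (at z) w)"
    and test_function_eq_0: "t \<notin> {t0<..<T} \<Longrightarrow> \<phi> (t, x) = 0"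
proof -
  have "C_k (Suc 0) \<phi>" using assms unfolding test_function_def by blast
  then show "(\<phi> has_derivative frechet_derivative \<phi> (at z)) (at z)"
    "continuous_on UNIV (\<lambda>z. frechet_derivative \<phi> (at z) w)"
    unfolding C_k.simps frechet_derivative_works[symmetric] by blast+
  show "\<phi> (t, x) = 0" if "t \<notin> {t0<..<T}"
    using assms that closure_subset[of "{z. \<phi> z \<noteq> 0}"] unfolding test_function_def by fastforce
qed

text \<open>The directional derivative is continuous, hence bounded on the compact support, and
  vanishes off it because \<phi> is locally zero there. These bounds provide the integrability for
  exchanging integrals.\<close>

lemma test_function_bounded_derivative:
  assumes \<phi>: "test_function t0 T \<phi>"
  obtains B where "\<And>z. \<bar>frechet_derivative \<phi> (at z) w\<bar> \<le> B"
proof -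
  let ?K = "closure {z. \<phi> z \<noteq> 0}"
  have zero: "frechet_derivative \<phi> (at z) w = 0" if "z \<notin> ?K" for z
  proof -
    have "0 = \<phi> y" if "y \<in> - ?K" for y
      using that closure_subset[of "{z. \<phi> z \<noteq> 0}"] by (metis (mono_tags) ComplD mem_Collect_eq subsetD)
    moreover have "z \<in> - ?K" using that by (simp only: Compl_iff not_False_eq_True)
    ultimately have "(\<phi> has_derivative (\<lambda>_. 0)) (at z)"
      by (intro has_derivative_transform_within_open[OF has_derivative_const open_Compl[OF closed_closure]])
    from frechet_derivative_at[OF this] show ?thesis
      by (rule fun_cong[symmetric])
  qed
  have "compact ((\<lambda>z. frechet_derivative \<phi> (at z) w) ` ?K)"
    using \<phi> test_function_continuous_derivative[OF \<phi>, of w]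
    by (intro compact_continuous_image) (auto simp: test_function_def intro: continuous_on_subset)
  then obtain B where B: "\<forall>d\<in>(\<lambda>z. frechet_derivative \<phi> (at z) w) ` ?K. norm d \<le> B"
    using compact_imp_bounded bounded_iff by blast
  have "\<bar>frechet_derivative \<phi> (at z) w\<bar> \<le> max 0 B" for z
    using B[rule_format, OF imageI, of z] zero[of z] by (cases "z \<in> ?K") auto
  then show thesis by (rule that)
qed

text \<open>The velocity varies with the point, whereas continuity and bounds are available for the
  derivative in a fixed direction; expanding in basis directions reduces the former to the
  latter.\<close>

lemma frechet_derivative_Pair_eq:
  fixes \<phi> :: "real \<times> 'a::euclidean_space \<Rightarrow> real"
  assumes "test_function t0 T \<phi>"
  shows "frechet_derivative \<phi> (at z) (c, v) = frechet_derivative \<phi> (at z) (c, 0) + frechet_derivative \<phi> (at z) (0, v)"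
    and "frechet_derivative \<phi> (at z) (0, v) = (\<Sum>b\<in>Basis. (v \<bullet> b) * frechet_derivative \<phi> (at z) (0, b))"
proof -
  interpret D: bounded_linear "frechet_derivative \<phi> (at z)"
    using test_function_has_derivative[OF assms] by (rule has_derivative_bounded_linear)
  show "frechet_derivative \<phi> (at z) (c, v) = frechet_derivative \<phi> (at z) (c, 0) + frechet_derivative \<phi> (at z) (0, v)"
    by (simp flip: D.add)
  have "(0, v) = (\<Sum>b\<in>Basis. (v \<bullet> b) *\<^sub>R (0 :: real, b))"
    by (simp add: prod_eq_iff fst_sum snd_sum euclidean_representation)
  then have "frechet_derivative \<phi> (at z) (0, v) = frechet_derivative \<phi> (at z) (\<Sum>b\<in>Basis. (v \<bullet> b) *\<^sub>R (0, b))"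
    by (rule arg_cong)
  then show "frechet_derivative \<phi> (at z) (0, v) = (\<Sum>b\<in>Basis. (v \<bullet> b) * frechet_derivative \<phi> (at z) (0, b))"
    by (simp only: D.sum D.scaleR real_scaleR_def)
qed

text \<open>
  By the last assumption on \<open>S\<close>, the half-open segment from \<open>S y\<close> (excluded) to \<open>y\<close> stays in the
  fibre of \<open>S\<close> over \<open>S y\<close>. The velocity of a particle travelling along it is therefore a function
  of its current position, and no disintegration is needed to define the vector field.
\<close>

locale straight_transport =
  fixes \<mu> :: "'a::euclidean_space measure" and S :: "'a \<Rightarrow> 'a" and D t0 T :: real
  assumes \<mu>: "\<mu> \<in> P2"
    and S [measurable]: "S \<in> borel_measurable borel"
    and S_bound: "\<And>y. norm (y - S y) \<le> D"
    and S_const: "\<And>y s. 0 < s \<Longrightarrow> s \<le> 1 \<Longrightarrow> S (S y + s *\<^sub>R (y - S y)) = S y"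
    and time: "t0 < T"
begin

sublocale prob_space \<mu>
  using \<mu> by (simp add: P2_def)

lemma sets_\<mu> [measurable_cong]: "sets \<mu> = sets borel"
  using \<mu> by (simp add: P2_def)

definition flow :: "real \<Rightarrow> 'a \<Rightarrow> 'a" where
  "flow t y = S y + ((t - t0) / (T - t0)) *\<^sub>R (y - S y)"

text \<open>The field vanishes at time \<open>t0\<close>, where the divisor is zero.\<close>

definition field :: "real \<Rightarrow> 'a \<Rightarrow> 'a" where
  "field t x = (1 / (t - t0)) *\<^sub>R (x - S x)"

definition velocity :: "'a \<Rightarrow> 'a" where
  "velocity y = (1 / (T - t0)) *\<^sub>R (y - S y)"

definition curve :: "real \<Rightarrow> 'a measure" where
  "curve t = distr \<mu> borel (flow t)"

section \<open>Flow, particle velocity and the field in spatial coordinates\<close>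

lemma D_nonneg: "0 \<le> D"
  using S_bound[of 0] norm_ge_zero order_trans by blast

lemma flow_measurable [measurable]: "flow t \<in> borel_measurable borel"
  unfolding flow_def by measurable

lemma velocity_measurable [measurable]: "velocity \<in> borel_measurable borel"
  unfolding velocity_def by measurable

lemma flow_measurable_pair [measurable]:
  assumes [measurable]: "f \<in> borel_measurable M" "g \<in> borel_measurable M"
  shows "(\<lambda>z. flow (f z) (g z)) \<in> borel_measurable M"
  unfolding flow_def by measurable

lemma field_measurable_pair [measurable]:
  assumes [measurable]: "f \<in> borel_measurable M" "g \<in> borel_measurable M"
  shows "(\<lambda>z. field (f z) (g z)) \<in> borel_measurable M"
  unfolding field_def by measurable

lemma norm_velocity_le: "norm (velocity y) \<le> D / (T - t0)"
  using S_bound[of y] time by (simp add: velocity_def divide_right_mono)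

text \<open>After time t0 the particle still lies in the fibre of \<open>S\<close> over its starting
  point, by \<open>S_const\<close>, so its displacement so far can be read off its position;
  dividing by t - t0 gives the velocity. At t0 itself particles with different velocities may share
  a position, hence the strict inequality.\<close>

lemma field_flow:
  assumes "t0 < t" "t \<le> T"
  shows "field t (flow t y) = velocity y"
proof -
  have "S (flow t y) = S y"
    unfolding flow_def using assms by (intro S_const) auto
  then show ?thesis
    using assms by (simp add: field_def velocity_def flow_def)
qed

lemma norm_field_flow_le:
  assumes "t \<in> {t0..T}"
  shows "norm (field t (flow t y)) \<le> D / (T - t0)"
proof (cases "t = t0")
  case True
  then show ?thesis using D_nonneg time by (simp add: field_def)
next
  case False
  then show ?thesis using assms norm_velocity_le[of y] by (simp add: field_flow)
qed

lemma curve_t0: "curve t0 = distr \<mu> borel S"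
  by (simp add: curve_def flow_def[abs_def])

lemma curve_T: "curve T = \<mu>"
  using time sets_\<mu> by (simp add: curve_def flow_def[abs_def] distr_id2)

lemma prob_space_curve: "prob_space (curve t)"
  unfolding curve_def by (intro prob_space_distr) measurable

section \<open>Admissibility of the curve and the field\<close>

lemma curve_in_P2:
  assumes t: "t \<in> {t0..T}"
  shows "curve t \<in> P2"
proof -
  \<comment> \<open>The particle is within D of its endpoint y, since only the fraction
    \<open>1 - ?u\<close> of a segment of length at most D remains.\<close>
  have bound: "(norm (flow t y))\<^sup>2 \<le> 2 * (norm y)\<^sup>2 + 2 * D\<^sup>2" for y
  proof -
    let ?u = "(t - t0) / (T - t0)"
    have u: "0 \<le> 1 - ?u" "1 - ?u \<le> 1" using t time by (auto simp: field_simps)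
    have "flow t y = y - (1 - ?u) *\<^sub>R (y - S y)"
      by (simp add: flow_def algebra_simps)
    then have "norm (flow t y) \<le> norm y + (1 - ?u) * norm (y - S y)"
      using norm_triangle_ineq4[of y "(1 - ?u) *\<^sub>R (y - S y)"] u by simp
    also have "\<dots> \<le> norm y + D"
      using mult_mono[of "1 - ?u" 1 "norm (y - S y)" D] u S_bound[of y] by simp
    finally have "(norm (flow t y))\<^sup>2 \<le> (norm y + D)\<^sup>2" by (intro power_mono) auto
    also have "\<dots> \<le> 2 * (norm y)\<^sup>2 + 2 * D\<^sup>2"
      using zero_le_power2[of "norm y - D"] by (simp add: power2_sum power2_diff)
    finally show ?thesis .
  qed
  have "integrable \<mu> (\<lambda>y. 2 * (norm y)\<^sup>2 + 2 * D\<^sup>2)"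
    using \<mu> by (auto simp: P2_def)
  then have "integrable \<mu> (\<lambda>y. (norm (flow t y))\<^sup>2)"
    by (rule Bochner_Integration.integrable_bound) (auto intro: order_trans[OF bound])
  then show ?thesis
    using prob_space_curve by (simp add: P2_def curve_def integrable_distr_eq)
qed

text \<open>Following the flow from s to t couples \<open>curve s\<close> with
  \<open>curve t\<close> and moves no point farther than (t - s) D / (T - t0). The curve is
  therefore Lipschitz, and a constant dominates its metric increments.\<close>

lemma AC_P2_curve: "AC_P2 t0 T curve"
  unfolding AC_P2_def
proof (intro conjI ballI exI[of _ "\<lambda>_. D / (T - t0)"])
  show "set_integrable lborel {t0..T} (\<lambda>_. D / (T - t0))"
    by (intro borel_integrable_atLeastAtMost' continuous_intros)
  fix s t assume st: "s \<in> {t0..T}" "t \<in> {s..T}"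
  let ?C = "(t - s) * (D / (T - t0))"
  have d: "dist (flow s y) (flow t y) \<le> ?C" for y
  proof -
    have "(t - s) / (T - t0) = (t - t0) / (T - t0) - (s - t0) / (T - t0)"
      by (simp flip: diff_divide_distrib)
    then have "flow t y - flow s y = ((t - s) / (T - t0)) *\<^sub>R (y - S y)"
      by (simp only: flow_def scaleR_left_diff_distrib add_diff_cancel_left)
    then have "dist (flow s y) (flow t y) = (t - s) / (T - t0) * norm (y - S y)"
      using st time by (simp add: dist_norm norm_minus_commute[of "flow s y"])
    also have "\<dots> \<le> (t - s) / (T - t0) * D"
      using st time by (intro mult_left_mono S_bound) auto
    finally show ?thesis by simp
  qed
  let ?\<gamma> = "distr \<mu> borel (\<lambda>y. (flow s y, flow t y))"
  have p: "(\<lambda>y. (flow s y, flow t y)) \<in> \<mu> \<rightarrow>\<^sub>M borel"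
    by (rule borel_measurable_Pair) auto
  have "?\<gamma> \<in> couplings (curve s) (curve t)"
    unfolding curve_def by (intro distr_Pair_in_couplings prob_space_axioms) auto
  moreover have "(\<integral>\<^sup>+ z. ennreal (dist (fst z) (snd z) ^ 2) \<partial>?\<gamma>)
      = (\<integral>\<^sup>+ y. ennreal ((dist (flow s y) (flow t y))\<^sup>2) \<partial>\<mu>)"
    using p by (subst nn_integral_distr) auto
  moreover have "\<dots> \<le> (\<integral>\<^sup>+ y. ennreal (?C\<^sup>2) \<partial>\<mu>)"
    by (intro nn_integral_mono ennreal_leI power_mono d) auto
  ultimately have "wasserstein 2 (curve s) (curve t) \<le> ?C"
    using st time D_nonneg by (intro wasserstein_le) (auto simp: emeasure_space_1)
  then show "wasserstein 2 (curve s) (curve t) \<le> (LBINT r:{s..t}. D / (T - t0))"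
    using st by (simp add: set_lebesgue_integral_def)
qed (fact curve_in_P2)

lemma L2_vector_field_field: "L2_vector_field t0 T curve field"
  unfolding L2_vector_field_def
proof
  have "(\<lambda>z. field (fst z) (snd z)) \<in> borel_measurable borel"
    by measurable
  moreover have "{t0..T} \<times> (UNIV :: 'a set) \<in> sets borel"
    by (intro borel_closed closed_Times) auto
  ultimately show "set_borel_measurable borel ({t0..T} \<times> UNIV) (\<lambda>(t, x). field t x)"
    by (simp add: set_borel_measurable_def split_beta' borel_measurable_scaleR)
  have "(\<integral>\<^sup>+ x. ennreal ((norm (field t x))\<^sup>2) \<partial>curve t) \<le> ennreal ((D / (T - t0))\<^sup>2)"
    if t: "t \<in> {t0..T}" for t
  proof -
    have "(\<integral>\<^sup>+ x. ennreal ((norm (field t x))\<^sup>2) \<partial>curve t)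
        = (\<integral>\<^sup>+ y. ennreal ((norm (field t (flow t y)))\<^sup>2) \<partial>\<mu>)"
      unfolding curve_def by (subst nn_integral_distr) auto
    also have "\<dots> \<le> (\<integral>\<^sup>+ y. ennreal ((D / (T - t0))\<^sup>2) \<partial>\<mu>)"
      by (intro nn_integral_mono ennreal_leI power_mono norm_field_flow_le t) auto
    finally show ?thesis by (simp add: emeasure_space_1)
  qed
  then have "(\<integral>\<^sup>+ t\<in>{t0..T}. (\<integral>\<^sup>+ x. ennreal ((norm (field t x))\<^sup>2) \<partial>curve t) \<partial>lborel)
      \<le> (\<integral>\<^sup>+ t\<in>{t0..T}. ennreal ((D / (T - t0))\<^sup>2) \<partial>lborel)"
    by (intro nn_integral_mono) (auto simp: indicator_def)
  also have "\<dots> < \<infinity>"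
    using time by (simp add: nn_integral_cmult_indicator ennreal_mult_less_top)
  finally show "(\<integral>\<^sup>+ t\<in>{t0..T}. (\<integral>\<^sup>+ x. ennreal ((norm (field t x))\<^sup>2) \<partial>curve t) \<partial>lborel) < \<infinity>" .
qed

lemma has_vector_derivative_along_flow:
  assumes "test_function t0 T \<phi>"
  shows "((\<lambda>t. \<phi> (t, flow t y)) has_vector_derivative
    frechet_derivative \<phi> (at (t, flow t y)) (1, velocity y)) (at t within A)"
proof -
  interpret D: bounded_linear "frechet_derivative \<phi> (at (t, flow t y))"
    using test_function_has_derivative[OF assms] by (rule has_derivative_bounded_linear)
  have "((\<lambda>t. (t, flow t y)) has_derivative (\<lambda>h. (h, h *\<^sub>R velocity y))) (at t within A)"
    unfolding flow_def velocity_def using time by (auto intro!: derivative_eq_intros simp: fun_eq_iff)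
  from has_derivative_compose[OF this test_function_has_derivative[OF assms]]
  have "((\<lambda>t. \<phi> (t, flow t y)) has_derivative
      (\<lambda>h. frechet_derivative \<phi> (at (t, flow t y)) (h *\<^sub>R (1, velocity y)))) (at t within A)"
    by simp
  then show ?thesis
    unfolding has_vector_derivative_def D.scaleR .
qed

text \<open>By the chain rule the integrand is the time derivative of \<phi> along a trajectory, and
  \<phi> vanishes at both end times because its support lies in the open time interval.\<close>

lemma integral_along_flow:
  assumes \<phi>: "test_function t0 T \<phi>"
  shows "(LBINT t:{t0<..<T}. frechet_derivative \<phi> (at (t, flow t y)) (1, velocity y)) = 0"
proof -
  let ?f = "\<lambda>t. frechet_derivative \<phi> (at (t, flow t y)) (1, velocity y)"
  have c: "continuous_on {t0..T} (\<lambda>t. (t, flow t y))"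
    unfolding flow_def by (intro continuous_intros) (use time in auto)
  have f: "continuous_on {t0..T} ?f"
    by (rule continuous_on_compose2[OF test_function_continuous_derivative[OF \<phi>] c]) auto
  \<comment> \<open>The fundamental theorem is applied on the closed interval; the two endpoints
    form a null set.\<close>
  have "(LBINT t:{t0<..<T}. ?f t) = (LBINT t:{t0..T}. ?f t)"
    unfolding set_lebesgue_integral_def
  proof (rule integral_cong_AE)
    have "set_integrable lborel {t0..T} ?f" "set_integrable lborel {t0<..<T} ?f"
      using borel_integrable_atLeastAtMost'[OF f] by (auto intro: set_integrable_subset)
    then show "(\<lambda>t. indicator {t0<..<T} t *\<^sub>R ?f t) \<in> borel_measurable lborel"
      "(\<lambda>t. indicator {t0..T} t *\<^sub>R ?f t) \<in> borel_measurable lborel"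
      unfolding set_integrable_def by (auto dest: borel_measurable_integrable)
    show "AE t in lborel. indicator {t0<..<T} t *\<^sub>R ?f t = indicator {t0..T} t *\<^sub>R ?f t"
      using AE_lborel_singleton[of t0] AE_lborel_singleton[of T]
      by eventually_elim (auto simp: indicator_def)
  qed
  also have "\<dots> = \<phi> (T, flow T y) - \<phi> (t0, flow t0 y)"
    unfolding set_lebesgue_integral_def using time f
    by (intro integral_FTC_atLeastAtMost has_vector_derivative_along_flow[OF \<phi>]) auto
  also have "\<dots> = 0" using test_function_eq_0[OF \<phi>] by simp
  finally show ?thesis .
qed

text \<open>Pulling the integral over \<open>curve t\<close> back to \<mu> turns the field into
  \<open>velocity y\<close> by \<open>field_flow\<close>. After exchanging the integrals, each
  single trajectory contributes 0 by \<open>integral_along_flow\<close>.\<close>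

lemma continuity_equation_field: "continuity_equation t0 T curve field"
  unfolding continuity_equation_def
proof (intro allI impI)
  fix \<phi> :: "real \<times> 'a \<Rightarrow> real" assume \<phi>: "test_function t0 T \<phi>"
  let ?D = "\<lambda>z. frechet_derivative \<phi> (at z)"
  have m [measurable]: "(\<lambda>z. ?D (f z, g z) w) \<in> borel_measurable M"
    if [measurable]: "f \<in> borel_measurable M" "g \<in> borel_measurable M" for f g w and M :: "'x measure"
  proof -
    have "(\<lambda>z. (f z, g z)) \<in> borel_measurable M" by (rule borel_measurable_Pair) fact+
    from measurable_compose[OF this borel_measurable_continuous_onI[OF test_function_continuous_derivative[OF \<phi>]]]
    show ?thesis .
  qed
  define f where "f t y = indicator {t0<..<T} t *\<^sub>R ?D (t, flow t y) (1, velocity y)" for t y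
  have f_eq: "f t y = indicator {t0<..<T} t *\<^sub>R (?D (t, flow t y) (1, 0)
      + (\<Sum>b\<in>Basis. (velocity y \<bullet> b) * ?D (t, flow t y) (0, b)))" for t y
    unfolding f_def frechet_derivative_Pair_eq(1)[OF \<phi>, of _ 1 "velocity y"]
      frechet_derivative_Pair_eq(2)[OF \<phi>, of _ "velocity y"] ..
  have eq: "(LINT x|curve t. ?D (t, x) (1, 0) + ?D (t, x) (0, field t x))
      = (LINT y|\<mu>. ?D (t, flow t y) (1, velocity y))" if t: "t \<in> {t0<..<T}" for t
  proof -
    have "(LINT x|curve t. ?D (t, x) (1, 0) + ?D (t, x) (0, field t x))
        = (LINT y|\<mu>. ?D (t, flow t y) (1, 0) + ?D (t, flow t y) (0, field t (flow t y)))"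
      unfolding curve_def frechet_derivative_Pair_eq(2)[OF \<phi>, of _ "field t _"]
      by (subst integral_distr) (auto intro!: borel_measurable_add borel_measurable_sum borel_measurable_times m)
    also have "\<dots> = (LINT y|\<mu>. ?D (t, flow t y) (1, velocity y))"
      using t by (simp add: field_flow frechet_derivative_Pair_eq(1)[OF \<phi>, of _ 1 "velocity _"])
    finally show ?thesis .
  qed
  interpret P: pair_sigma_finite lborel \<mu> ..
  \<comment> \<open>For Fubini: f is bounded and vanishes outside a time strip of finite product
    measure.\<close>
  have int: "integrable (lborel \<Otimes>\<^sub>M \<mu>) (\<lambda>(t, y). f t y)"
  proof -
    obtain B0 where B0: "\<And>z. \<bar>?D z (1, 0)\<bar> \<le> B0"
      using test_function_bounded_derivative[OF \<phi>] by blast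
    have "\<forall>b. \<exists>B. \<forall>z. \<bar>?D z (0, b)\<bar> \<le> B"
      using test_function_bounded_derivative[OF \<phi>] by metis
    then obtain B where B: "\<And>b z. \<bar>?D z (0, b)\<bar> \<le> B b" by metis
    let ?B = "B0 + (\<Sum>b\<in>Basis. D / (T - t0) * B b)"
    have bound: "\<bar>f t y\<bar> \<le> ?B" for t y
    proof -
      have "\<bar>\<Sum>b\<in>Basis. (velocity y \<bullet> b) * ?D (t, flow t y) (0, b)\<bar> \<le> (\<Sum>b\<in>Basis. D / (T - t0) * B b)"
      proof (rule order_trans[OF sum_abs], rule sum_mono)
        fix b :: 'a assume "b \<in> Basis"
        then have "\<bar>velocity y \<bullet> b\<bar> \<le> D / (T - t0)"
          using Basis_le_norm[of b "velocity y"] norm_velocity_le[of y] by simp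
        then show "\<bar>(velocity y \<bullet> b) * ?D (t, flow t y) (0, b)\<bar> \<le> D / (T - t0) * B b"
          unfolding abs_mult using B D_nonneg time by (intro mult_mono) auto
      qed
      then have "\<bar>?D (t, flow t y) (1, 0) + (\<Sum>b\<in>Basis. (velocity y \<bullet> b) * ?D (t, flow t y) (0, b))\<bar> \<le> ?B"
        using B0[of "(t, flow t y)"] by linarith
      then show ?thesis
        unfolding f_eq by (auto simp: indicator_def)
    qed
    show ?thesis
    proof (rule integrableI_bounded_set[where A = "{t0<..<T} \<times> space \<mu>" and B = ?B])
      show "(\<lambda>(t, y). f t y) \<in> borel_measurable (lborel \<Otimes>\<^sub>M \<mu>)"
        unfolding f_eq split_beta' by measurable
      show "emeasure (lborel \<Otimes>\<^sub>M \<mu>) ({t0<..<T} \<times> space \<mu>) < \<infinity>"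
        by (subst emeasure_pair_measure_Times) (use time in \<open>auto simp: emeasure_space_1 ennreal_mult_less_top less_imp_le\<close>)
      show "AE z in lborel \<Otimes>\<^sub>M \<mu>. z \<in> {t0<..<T} \<times> space \<mu> \<longrightarrow> norm (case z of (t, y) \<Rightarrow> f t y) \<le> ?B"
        unfolding split_beta' real_norm_def by (intro AE_I2 impI bound)
      show "AE z in lborel \<Otimes>\<^sub>M \<mu>. z \<notin> {t0<..<T} \<times> space \<mu> \<longrightarrow> (case z of (t, y) \<Rightarrow> f t y) = 0"
        by (rule AE_I2) (auto simp: f_def space_pair_measure split: split_indicator_asm)
    qed auto
  qed
  have "(LBINT t:{t0<..<T}. LINT x|curve t. ?D (t, x) (1, 0) + ?D (t, x) (0, field t x))
      = (LINT t|lborel. LINT y|\<mu>. f t y)"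
    unfolding set_lebesgue_integral_def f_def
    by (intro Bochner_Integration.integral_cong refl) (auto simp: eq indicator_def)
  also have "\<dots> = (LINT y|\<mu>. LINT t|lborel. f t y)"
    by (rule P.Fubini_integral[OF int, symmetric])
  also have "\<dots> = 0"
    using integral_along_flow[OF \<phi>] by (simp add: f_def set_lebesgue_integral_def)
  finally show "(LBINT t:{t0<..<T}. LINT x|curve t. ?D (t, x) (1, 0) + ?D (t, x) (0, field t x)) = 0" .
qed

section \<open>Cost of the transport and upper bound for the mean field value\<close>

lemma kinetic_energy_le:
  "(LBINT t:{t0..T}. LINT x|curve t. 1 / 2 * (norm (field t x))\<^sup>2) \<le> D\<^sup>2 / (2 * (T - t0))"
proof -
  let ?K = "(D / (T - t0))\<^sup>2 / 2"
  have le: "(LINT x|curve t. 1 / 2 * (norm (field t x))\<^sup>2) \<le> ?K" if t: "t \<in> {t0..T}" for t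
  proof -
    have "(LINT x|curve t. 1 / 2 * (norm (field t x))\<^sup>2) = (LINT y|\<mu>. 1 / 2 * (norm (field t (flow t y)))\<^sup>2)"
      unfolding curve_def by (subst integral_distr) auto
    also have "\<dots> \<le> (LINT y|\<mu>. ?K)"
    proof (rule integral_mono_AE')
      show "AE y in \<mu>. 1 / 2 * (norm (field t (flow t y)))\<^sup>2 \<le> ?K"
        using power_mono[OF norm_field_flow_le[OF t], of _ 2] by auto
    qed auto
    also have "\<dots> = ?K" by (simp add: prob_space)
    finally show ?thesis .
  qed
  \<comment> \<open>Integrability is checked for the bound alone: a nonintegrable left side would
    have integral 0 by convention, still below the nonnegative right side.\<close>
  have "(LBINT t:{t0..T}. LINT x|curve t. 1 / 2 * (norm (field t x))\<^sup>2) \<le> (LBINT t:{t0..T}. ?K)"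
    unfolding set_lebesgue_integral_def
  proof (rule integral_mono_AE')
    show "AE t in lborel. indicator {t0..T} t *\<^sub>R (LINT x|curve t. 1 / 2 * (norm (field t x))\<^sup>2)
        \<le> indicator {t0..T} t *\<^sub>R ?K"
      using le by (auto simp: indicator_def)
    show "integrable lborel (\<lambda>t. indicator {t0..T} t *\<^sub>R ?K)"
      using borel_integrable_atLeastAtMost'[of t0 T "\<lambda>_. ?K"] by (simp add: set_integrable_def)
  qed auto
  also have "\<dots> = D\<^sup>2 / (2 * (T - t0))"
    using time by (simp add: set_lebesgue_integral_def power2_eq_square)
  finally show ?thesis .
qed

text \<open>The pair of \<open>curve\<close> and \<open>field\<close> is a competitor. Nonnegativity
  of G bounds the set of costs below, so that its infimum is at most the cost of this
  competitor.\<close>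

lemma mean_field_value_le:
  assumes G: "\<And>m. 0 \<le> G m"
  shows "mean_field_value G T t0 (distr \<mu> borel S) \<le> D\<^sup>2 / (2 * (T - t0)) + G \<mu>"
proof -
  let ?A = "{(LBINT t:{t0..T}. LINT x|m t. 1 / 2 * (norm (\<alpha> t x))\<^sup>2) + G (m T) | m \<alpha>.
    AC_P2 t0 T m \<and> L2_vector_field t0 T m \<alpha> \<and> continuity_equation t0 T m \<alpha> \<and> m t0 = distr \<mu> borel S}"
  have bdd: "bdd_below ?A"
  proof (rule bdd_belowI[of _ 0])
    fix z assume "z \<in> ?A"
    then show "0 \<le> z"
      unfolding mem_Collect_eq set_lebesgue_integral_def
      by (elim exE conjE) (auto intro!: add_nonneg_nonneg integral_nonneg G)
  qed
  have "(LBINT t:{t0..T}. LINT x|curve t. 1 / 2 * (norm (field t x))\<^sup>2) + G (curve T) \<in> ?A"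
    unfolding mem_Collect_eq
    by (intro exI[of _ curve] exI[of _ field] conjI refl AC_P2_curve L2_vector_field_field
        continuity_equation_field curve_t0)
  from cInf_lower[OF this bdd] have "mean_field_value G T t0 (distr \<mu> borel S)
      \<le> (LBINT t:{t0..T}. LINT x|curve t. 1 / 2 * (norm (field t x))\<^sup>2) + G (curve T)"
    unfolding mean_field_value_def .
  also have "\<dots> \<le> D\<^sup>2 / (2 * (T - t0)) + G \<mu>"
    unfolding curve_T by (rule add_right_mono[OF kinetic_energy_le])
  finally show ?thesis .
qed

end

subsection \<open>The unit cube\<close>

lemma sets_lebesgue_unit_cube [measurable_cong, simp]: "sets lebesgue_unit_cube = sets borel"
  by (simp add: lebesgue_unit_cube_def)

lemma space_lebesgue_unit_cube [simp]: "space lebesgue_unit_cube = UNIV"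
  by (simp add: lebesgue_unit_cube_def)

lemma emeasure_lebesgue_unit_cube:
  assumes "A \<in> sets borel"
  shows "emeasure (lebesgue_unit_cube :: (real ^ 'd) measure) A = emeasure lborel (cbox 0 1 \<inter> A)"
  using assms by (simp add: lebesgue_unit_cube_def emeasure_density nn_integral_indicator
      flip: indicator_inter_arith)

lemma One_vec: "(One :: real ^ 'd) = 1"
proof (rule euclidean_eqI)
  fix b :: "real ^ 'd" assume b: "b \<in> Basis"
  then obtain i where "b = axis i 1" by (auto simp: Basis_vec_def)
  then have "1 \<bullet> b = 1" by (simp add: inner_axis)
  with b show "One \<bullet> b = 1 \<bullet> b" by simp
qed

lemma prob_space_lebesgue_unit_cube: "prob_space (lebesgue_unit_cube :: (real ^ 'd) measure)"
proof (rule prob_spaceI)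
  have "emeasure lborel (cbox 0 (One :: real ^ 'd)) = 1"
    by (subst emeasure_lborel_cbox) auto
  then show "emeasure (lebesgue_unit_cube :: (real ^ 'd) measure) (space lebesgue_unit_cube) = 1"
    by (simp add: emeasure_lebesgue_unit_cube One_vec)
qed

lemma lebesgue_unit_cube_in_P2: "(lebesgue_unit_cube :: (real ^ 'd) measure) \<in> P2"
proof -
  obtain C where "\<And>x. x \<in> cbox 0 (1 :: real ^ 'd) \<Longrightarrow> norm x \<le> C"
    using bounded_cbox[of 0 "1 :: real ^ 'd"] by (auto simp: bounded_iff)
  then have "AE x in (lebesgue_unit_cube :: (real ^ 'd) measure). norm x \<le> C"
    unfolding lebesgue_unit_cube_def by (subst AE_density) (auto simp: indicator_def)
  then show ?thesis
    by (intro bounded_in_P2 prob_space_lebesgue_unit_cube) auto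
qed

text \<open>Supplies the premises of \<open>straight_transport\<close> for the cube:
  \<open>S\<close> sends each box of an equal-volume partition to its lower corner, and x lists
  these corners. The number h is the side of a cube of volume 1 / N.\<close>

lemma transport_unit_cube:
  fixes h :: real
  assumes N: "N > 0" and h: "h \<ge> 0" "real N * h ^ CARD('d) = 1"
  obtains x :: "nat \<Rightarrow> real ^ 'd" and S where "\<And>i. i < N \<Longrightarrow> x i \<in> cbox 0 1"
    and "S \<in> borel_measurable borel" and "\<And>y. norm (y - S y) \<le> 3 * real CARD('d) * h"
    and "\<And>y s. 0 < s \<Longrightarrow> s \<le> 1 \<Longrightarrow> S (S y + s *\<^sub>R (y - S y)) = S y"
    and "distr lebesgue_unit_cube borel S = empirical_measure N x"
proof -
  let ?\<mu> = "lebesgue_unit_cube :: (real ^ 'd) measure"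
  interpret prob_space ?\<mu> by (rule prob_space_lebesgue_unit_cube)
  have "fat_box 0 (One :: real ^ 'd)" by (auto simp: fat_box_def)
  from fat_box_partition[OF N this] obtain p q :: "nat \<Rightarrow> real ^ 'd"
    where pq: "\<And>i. i < N \<Longrightarrow> fat_box (p i) (q i) \<and> box (p i) (q i) \<subseteq> box 0 1 \<and>
        (\<Prod>e\<in>Basis. (q i - p i) \<bullet> e) = 1 / real N"
      and disj: "disjoint_family_on (\<lambda>i. box (p i) (q i)) {..<N}"
    unfolding One_vec by (auto simp flip: One_vec)
  let ?B = "\<lambda>i. box (p i) (q i)"
  \<comment> \<open>At most one indicator is nonzero, so this is \<open>p i\<close> on the i-th box
    and the identity elsewhere, in a form that is visibly measurable. Being the identity off the
    boxes makes the displacement bound and the fibre condition hold for every y, not just almost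
    every y.\<close>
  define S where "S y = y - (\<Sum>i<N. indicator (?B i) y *\<^sub>R (y - p i))" for y
  have S_in: "S y = p i" if "i < N" "y \<in> ?B i" for y i
  proof -
    have "indicator (?B j) y *\<^sub>R (y - p j) = (if j = i then y - p i else 0)" if "j < N" for j
      using disj \<open>i < N\<close> \<open>y \<in> ?B i\<close> that by (auto simp: disjoint_family_on_def indicator_def)
    then have "(\<Sum>j<N. indicator (?B j) y *\<^sub>R (y - p j)) = (\<Sum>j<N. if j = i then y - p i else 0)"
      by (intro sum.cong) auto
    then show ?thesis using \<open>i < N\<close> by (simp add: S_def)
  qed
  have S_out: "S y = y" if "\<And>i. i < N \<Longrightarrow> y \<notin> ?B i" for y
    using that by (simp add: S_def)
  have S_meas [measurable]: "S \<in> borel_measurable borel"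
    unfolding S_def by measurable
  have "p i \<in> cbox 0 1" if i: "i < N" for i
  proof -
    have "box (p i) (q i) \<noteq> {}" using pq[OF i] by (auto simp: fat_box_def box_ne_empty)
    then have "p i \<in> closure (box (p i) (q i))" using pq[OF i]
      by (subst closure_box) (auto simp: fat_box_def mem_box less_imp_le)
    also have "\<dots> \<subseteq> cbox 0 1"
      using pq[OF i] box_subset_cbox[of 0 "1 :: real ^ 'd"] by (intro closure_minimal) auto
    finally show ?thesis .
  qed
  moreover have "norm (y - S y) \<le> 3 * real CARD('d) * h" for y
  proof (cases "\<exists>i<N. y \<in> ?B i")
    case True
    then obtain i where i: "i < N" "y \<in> ?B i" by blast
    have "1 / real N = h ^ DIM(real ^ 'd)"
      using h(2) N by (simp add: field_simps)
    then show ?thesis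
      using norm_diff_fat_box_le[of "p i" "q i" h y] pq[OF i(1)] h(1) i by (simp add: S_in mult_ac)
  next
    case False
    then show ?thesis using h by (simp add: S_out)
  qed
  moreover have "S (S y + s *\<^sub>R (y - S y)) = S y" if s: "0 < s" "s \<le> 1" for y s
  proof (cases "\<exists>i<N. y \<in> ?B i")
    case True
    then obtain i where i: "i < N" "y \<in> ?B i" by blast
    \<comment> \<open>The corner is outside the open box, but s > 0 pushes every coordinate strictly
      past it, and s \<le> 1 keeps every coordinate at most that of y.\<close>
    have "p i + s *\<^sub>R (y - p i) \<in> ?B i"
      unfolding mem_box
    proof (intro ballI conjI)
      fix e :: "real ^ 'd" assume e: "e \<in> Basis"
      have y: "0 < (y - p i) \<bullet> e" "y \<bullet> e < q i \<bullet> e"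
        using i e by (auto simp: mem_box inner_diff_left)
      have "0 < s * ((y - p i) \<bullet> e)" "s * ((y - p i) \<bullet> e) \<le> (y - p i) \<bullet> e"
        using y s mult_right_mono[of s 1 "(y - p i) \<bullet> e"] by auto
      then show "p i \<bullet> e < (p i + s *\<^sub>R (y - p i)) \<bullet> e" "(p i + s *\<^sub>R (y - p i)) \<bullet> e < q i \<bullet> e"
        using y by (auto simp: inner_add_left inner_diff_left)
    qed
    then show ?thesis using i by (simp add: S_in)
  next
    case False
    then show ?thesis by (simp add: S_out)
  qed
  moreover have "distr ?\<mu> borel S = empirical_measure N p"
  proof (rule measure_eqI)
    interpret E: prob_space "empirical_measure N p"
      by (rule prob_space_empirical_measure[OF N])
    interpret D: prob_space "distr ?\<mu> borel S" by (rule prob_space_distr) auto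
    have box: "prob (?B i) = 1 / real N" if i: "i < N" for i
    proof -
      have "emeasure ?\<mu> (?B i) = emeasure lborel (?B i)"
        using pq[OF i] box_subset_cbox[of 0 "1 :: real ^ 'd"]
        by (subst emeasure_lebesgue_unit_cube) (auto intro!: arg_cong[where f = "emeasure lborel"])
      also have "\<dots> = ennreal (1 / real N)"
        using pq[OF i] by (subst emeasure_lborel_box) (auto simp: fat_box_def less_imp_le)
      finally show ?thesis
        by (simp add: emeasure_eq_measure)
    qed
    have union: "prob (A \<inter> (\<Union>i<N. ?B i)) = (\<Sum>i<N. prob (A \<inter> ?B i))" if "A \<in> sets borel" for A
    proof -
      have eq: "A \<inter> (\<Union>i<N. ?B i) = (\<Union>i<N. A \<inter> ?B i)" by blast
      have "disjoint_family_on (\<lambda>i. A \<inter> ?B i) {..<N}"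
        using disj by (rule disjoint_family_on_bisimulation) auto
      with that show ?thesis
        unfolding eq by (intro finite_measure_finite_Union) auto
    qed
    \<comment> \<open>N disjoint boxes of mass 1 / N use up the total mass, so the set outside the
      boxes, where \<open>S\<close> is the identity, is null.\<close>
    have full: "prob (\<Union>i<N. ?B i) = 1"
      using union[of UNIV] box N by simp
    fix A assume "A \<in> sets (distr ?\<mu> borel S)"
    then have A [measurable]: "A \<in> sets borel" by simp
    have A' [measurable]: "S -` A \<in> sets borel"
      using measurable_sets[OF S_meas A] by simp
    have "measure (distr ?\<mu> borel S) A = prob (S -` A)"
      by (subst measure_distr) auto
    also have "\<dots> = prob (S -` A \<inter> (\<Union>i<N. ?B i))"
      using AE_prob_1[OF full] by (intro finite_measure_eq_AE) auto
    also have "\<dots> = (\<Sum>i<N. prob (S -` A \<inter> ?B i))"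
      by (rule union) auto
    also have "\<dots> = (\<Sum>i<N. 1 / real N * indicator A (p i))"
    proof (intro sum.cong refl)
      fix i assume "i \<in> {..<N}"
      then have "S -` A \<inter> ?B i = (if p i \<in> A then ?B i else {})" using S_in by auto
      then show "prob (S -` A \<inter> ?B i) = 1 / real N * indicator A (p i)"
        using box \<open>i \<in> {..<N}\<close> by simp
    qed
    also have "\<dots> = measure (empirical_measure N p) A"
      using A by (simp add: measure_empirical_measure sum_distrib_left)
    finally show "emeasure (distr ?\<mu> borel S) A = emeasure (empirical_measure N p) A"
      by (simp add: E.emeasure_eq_measure D.emeasure_eq_measure)
  qed (simp add: empirical_measure_def)
  ultimately show thesis using S_meas that by blast
qed

section \<open>Comparison of the two value functions\<close>

theorem proposition6p8:
  shows "\<exists>c_d > 0. \<forall>T \<ge> 1 / 2. \<exists>N0. \<forall>N \<ge> N0.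
    \<exists>x :: nat \<Rightarrow> real ^ 'd. (\<forall>i<N. x i \<in> cbox 0 1) \<and>
      particle_value terminal_cost T N (T - 1 / 2) x
        - mean_field_value terminal_cost T (T - 1 / 2) (empirical_measure N x)
      \<ge> c_d * real N powr (- 1 / real CARD('d))"
proof (intro exI[of _ "1 / 16"] conjI allI impI)
  \<comment> \<open>The constant is 1/16 = 1/8 - 1/16: with h = N^(-1/d) the particle value is at
    least h / 8 and, for large N, the mean field value is at most h / 16. The dimension enters only
    through the size of N.\<close>
  let ?d = "real CARD('d)" and ?\<mu> = "lebesgue_unit_cube :: (real ^ 'd) measure"
  fix T :: real
  have "(\<lambda>N. real N powr (- 1 / ?d)) \<longlonglongrightarrow> 0"
    by (rule tendsto_neg_powr[OF _ filterlim_real_sequentially]) simp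
  \<comment> \<open>Since 144 = 16 * 9, this threshold makes the transport cost 9 d^2 h^2 at most h
    / 16.\<close>
  then have "eventually (\<lambda>N. real N powr (- 1 / ?d) < 1 / (144 * ?d\<^sup>2)) sequentially"
    by (rule order_tendstoD) simp
  with eventually_gt_at_top[of 0]
  have "eventually (\<lambda>N. N > 0 \<and> real N powr (- 1 / ?d) < 1 / (144 * ?d\<^sup>2)) sequentially"
    by eventually_elim simp
  then obtain N0 where N0: "\<And>N. N \<ge> N0 \<Longrightarrow> N > 0 \<and> real N powr (- 1 / ?d) < 1 / (144 * ?d\<^sup>2)"
    by (auto simp: eventually_sequentially)
  show "\<exists>N0. \<forall>N \<ge> N0. \<exists>x :: nat \<Rightarrow> real ^ 'd. (\<forall>i<N. x i \<in> cbox 0 1) \<and>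
      particle_value terminal_cost T N (T - 1 / 2) x
        - mean_field_value terminal_cost T (T - 1 / 2) (empirical_measure N x)
      \<ge> 1 / 16 * real N powr (- 1 / ?d)"
  proof (intro exI[of _ N0] allI impI)
    fix N assume "N \<ge> N0"
    define h where "h = real N powr (- 1 / ?d)"
    have N: "N > 0" and small: "h < 1 / (144 * ?d\<^sup>2)"
      using N0[OF \<open>N \<ge> N0\<close>] by (auto simp: h_def)
    have h: "h > 0" using N by (simp add: h_def)
    have "h ^ CARD('d) = real N powr (- 1)"
      using N by (simp add: h_def powr_power)
    then have hd: "real N * h ^ CARD('d) = 1"
      using N by (simp add: powr_minus_divide)
    obtain x :: "nat \<Rightarrow> real ^ 'd" and S where x: "\<And>i. i < N \<Longrightarrow> x i \<in> cbox 0 1"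
      and S: "S \<in> borel_measurable borel" "\<And>y. norm (y - S y) \<le> 3 * ?d * h"
        "\<And>y s. 0 < s \<Longrightarrow> s \<le> 1 \<Longrightarrow> S (S y + s *\<^sub>R (y - S y)) = S y"
      and emp: "distr ?\<mu> borel S = empirical_measure N x"
      by (rule transport_unit_cube[OF N less_imp_le[OF h] hd]) (rule that)
    interpret straight_transport ?\<mu> S "3 * ?d * h" "T - 1 / 2" T
      by unfold_locales (use S lebesgue_unit_cube_in_P2 in auto)
    have "mean_field_value terminal_cost T (T - 1 / 2) (empirical_measure N x)
        \<le> (3 * ?d * h)\<^sup>2 / (2 * (T - (T - 1 / 2))) + terminal_cost ?\<mu>"
      unfolding emp[symmetric]
      by (rule mean_field_value_le) (simp add: terminal_cost_def wasserstein_nonneg)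
    \<comment> \<open>The duration 1/2 makes the denominator 1, and the terminal cost vanishes
      because the transport ends exactly at Lebesgue measure on the cube.\<close>
    also have "\<dots> = 9 * ?d\<^sup>2 * h * h"
      using wasserstein_1_self[OF lebesgue_unit_cube_in_P2]
      by (simp add: terminal_cost_def power2_eq_square)
    also have "\<dots> \<le> h / 16"
    proof -
      have "9 * ?d\<^sup>2 * h \<le> 1 / 16" using small by (simp add: field_simps)
      from mult_right_mono[OF this, of h] h show ?thesis by simp
    qed
    finally have U: "mean_field_value terminal_cost T (T - 1 / 2) (empirical_measure N x) \<le> h / 16" .
    \<comment> \<open>Quantization with radius h / 4: the N enclosing cubes of side h / 2 have total
      volume 2^(-d) \<le> 1/2. The bound applies to every final configuration y, inside the cube or
      not.\<close>
    have "h / 4 / 2 \<le> particle_value terminal_cost T N (T - 1 / 2) x"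
    proof (rule particle_value_ge)
      fix y :: "nat \<Rightarrow> real ^ 'd"
      have "real N * (2 * (h / 4)) ^ DIM(real ^ 'd) = (1 / 2) ^ CARD('d)"
        using hd by (simp add: power_divide)
      also have "\<dots> \<le> (1 / 2) ^ 1" by (rule power_decreasing) (auto simp: Suc_leI)
      finally have *: "real N * (2 * (h / 4)) ^ DIM(real ^ 'd) \<le> 1 / 2" by simp
      show "h / 4 / 2 \<le> terminal_cost (empirical_measure N y)"
        unfolding terminal_cost_def
        using * h N
        by (intro wasserstein_1_empirical_measure_ge lebesgue_unit_cube_in_P2)
           (auto simp: emeasure_lebesgue_unit_cube intro!: emeasure_mono)
    qed
    with U x show "\<exists>x :: nat \<Rightarrow> real ^ 'd. (\<forall>i<N. x i \<in> cbox 0 1) \<and>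
        particle_value terminal_cost T N (T - 1 / 2) x
          - mean_field_value terminal_cost T (T - 1 / 2) (empirical_measure N x)
        \<ge> 1 / 16 * real N powr (- 1 / ?d)"
      unfolding h_def[symmetric] by (intro exI[of _ x]) auto
  qed
qed simp

end
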